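(* Let $V$ be a finite dimensional euclidean vector space over $\mathbf{R}$, let $1\le p<2$, and let $\gamma:[0,T]\to V$ be a continuous path of finite $p$-variation with image $S_\gamma=\gamma([0,T])$. Let $f,g,h:S_\gamma\to\mathbf{C}$ be Lipschitz functions such that the convex hull $\mathrm{h}(f(S_\gamma))\subset\mathbf{C}$ of $f(S_\gamma)$ does not contain $0$, and let $\log$ be a continuous branch of the logarithm on $\mathrm{h}(f(S_\gamma))$. If $|\log z|<\log 2$ for all $z\in \mathrm{h}(f(S_\gamma))$, then for every $s\in\mathbf{C}$ the series $$\sum_{n=0}^{\infty}(-1)^n\binom{s}{n}\left(\sum_{k=0}^{n}(-1)^k\binom{n}{k}\int_\gamma f^k g\,dh\right)$$ converges to $\int_\gamma f^s g\,dh$.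
   Context: Here $f^s=\exp(s\log f)$ with the given branch of $\log$. For Lipschitz functions $u,h:S_\gamma\to\mathbf{C}$ (with $S_\gamma$ carrying the metric inherited from $V$), $\int_\gamma u\,dh$ denotes the Young integral $\int_0^T (u\circ\gamma)(t)\,d(h\circ\gamma)(t)$, i.e. the limit of Riemann–Stieltjes sums; it exists because $u\circ\gamma$ and $h\circ\gamma$ have finite $p$-variation with $p<2$. $\binom{s}{n}=s(s-1)\cdots(s-n+1)/n!$ for $s\in\mathbf{C}$. The series is an iterated sum: the finite inner sums over $k$ are computed first, then the series in $n$ is summed. *)

theory Defs
  imports "HOL-Analysis.Analysis"
begin

text \<open>A subdivision of \<open>[a, b]\<close> is given by its points \<open>t 0 \<le> \<dots> \<le> t n\<close>. Repeated points are
  allowed; they contribute \<open>0\<close> to every sum below.\<close>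

definition subdivision :: "real \<Rightarrow> real \<Rightarrow> nat \<Rightarrow> (nat \<Rightarrow> real) \<Rightarrow> bool" where
  "subdivision a b n t \<longleftrightarrow> t 0 = a \<and> t n = b \<and> (\<forall>i<n. t i \<le> t (Suc i))"

definition finite_p_variation ::
    "real \<Rightarrow> real \<Rightarrow> real \<Rightarrow> (real \<Rightarrow> 'a::metric_space) \<Rightarrow> bool" where
  "finite_p_variation p a b x \<longleftrightarrow>
     bdd_above {\<Sum>i<n. dist (x (t i)) (x (t (Suc i))) powr p | n t. subdivision a b n t}"

text \<open>The Young integral of \<open>F\<close> against \<open>G\<close> over \<open>[a, b]\<close>: the limit of the Riemann--Stieltjes
  sums, with arbitrary tags \<open>\<xi> i\<close>, as the mesh of the subdivision tends to \<open>0\<close>.\<close>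

definition has_young_integral ::
    "(real \<Rightarrow> complex) \<Rightarrow> (real \<Rightarrow> complex) \<Rightarrow> real \<Rightarrow> real \<Rightarrow> complex \<Rightarrow> bool" where
  "has_young_integral F G a b I \<longleftrightarrow>
     (\<forall>e>0. \<exists>d>0. \<forall>n t \<xi>.
        subdivision a b n t \<and> (\<forall>i<n. t (Suc i) - t i < d) \<and> (\<forall>i<n. \<xi> i \<in> {t i..t (Suc i)}) \<longrightarrow>
        cmod ((\<Sum>i<n. F (\<xi> i) * (G (t (Suc i)) - G (t i))) - I) < e)"

definition young_integrable ::
    "(real \<Rightarrow> complex) \<Rightarrow> (real \<Rightarrow> complex) \<Rightarrow> real \<Rightarrow> real \<Rightarrow> bool" where
  "young_integrable F G a b \<longleftrightarrow> (\<exists>I. has_young_integral F G a b I)"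

definition young_integral ::
    "(real \<Rightarrow> complex) \<Rightarrow> (real \<Rightarrow> complex) \<Rightarrow> real \<Rightarrow> real \<Rightarrow> complex" where
  "young_integral F G a b = (THE I. has_young_integral F G a b I)"

lemma subdivision_fine_exists:
  assumes "a \<le> b" "0 < d"
  obtains n t where "subdivision a b n t" "\<And>i. i < n \<Longrightarrow> t (Suc i) - t i < d"
proof -
  obtain m :: nat where m: "(b - a) / d < real m" using reals_Archimedean2 by blast
  have m0: "0 < real m"
    using m assms by (meson diff_ge_0_iff_ge divide_nonneg_pos le_less_trans)
  define t where "t i = a + real i * ((b - a) / real m)" for i
  have step: "t (Suc i) - t i = (b - a) / real m" for i
    unfolding t_def by (simp add: distrib_right del: times_divide_eq_right)
  have nonneg: "0 \<le> (b - a) / real m" using assms by simp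
  have "subdivision a b m t"
    unfolding subdivision_def
  proof (intro conjI allI impI)
    show "t 0 = a" by (simp add: t_def)
    show "t m = b" using m0 by (simp add: t_def)
    show "t i \<le> t (Suc i)" for i using step[of i] nonneg by linarith
  qed
  moreover have "(b - a) / real m < d"
    using m m0 assms(2) by (simp add: field_simps)
  ultimately show ?thesis using that step by metis
qed

lemma has_young_integral_unique:
  assumes "a \<le> b" and I: "has_young_integral F G a b I" and J: "has_young_integral F G a b J"
  shows "I = J"
proof (rule ccontr)
  assume "I \<noteq> J"
  define e where "e = cmod (I - J) / 2"
  have e: "0 < e" using \<open>I \<noteq> J\<close> by (simp add: e_def)
  obtain d1 where d1: "0 < d1" "\<forall>n t \<xi>. subdivision a b n t \<and> (\<forall>i<n. t (Suc i) - t i < d1) \<and>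
      (\<forall>i<n. \<xi> i \<in> {t i..t (Suc i)}) \<longrightarrow>
      cmod ((\<Sum>i<n. F (\<xi> i) * (G (t (Suc i)) - G (t i))) - I) < e"
    using I[unfolded has_young_integral_def, THEN spec, THEN mp, OF e] by (elim exE conjE)
  obtain d2 where d2: "0 < d2" "\<forall>n t \<xi>. subdivision a b n t \<and> (\<forall>i<n. t (Suc i) - t i < d2) \<and>
      (\<forall>i<n. \<xi> i \<in> {t i..t (Suc i)}) \<longrightarrow>
      cmod ((\<Sum>i<n. F (\<xi> i) * (G (t (Suc i)) - G (t i))) - J) < e"
    using J[unfolded has_young_integral_def, THEN spec, THEN mp, OF e] by (elim exE conjE)
  obtain n t where t: "subdivision a b n t" "\<And>i. i < n \<Longrightarrow> t (Suc i) - t i < min d1 d2"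
    using subdivision_fine_exists[OF \<open>a \<le> b\<close>, of "min d1 d2"] d1(1) d2(1) by auto
  have tags: "\<forall>i<n. t i \<in> {t i..t (Suc i)}" using t(1) by (simp add: subdivision_def)
  define R where "R = (\<Sum>i<n. F (t i) * (G (t (Suc i)) - G (t i)))"
  have "cmod (R - I) < e"
    unfolding R_def
    by (rule d1(2)[THEN spec, of n, THEN spec, of t, THEN spec, of t, THEN mp]) (use t tags in simp)
  moreover have "cmod (R - J) < e"
    unfolding R_def
    by (rule d2(2)[THEN spec, of n, THEN spec, of t, THEN spec, of t, THEN mp]) (use t tags in simp)
  ultimately have "cmod (I - J) < 2 * e"
    using norm_triangle_ineq4[of "R - J" "R - I"] by simp
  then show False by (simp add: e_def)
qed

lemma young_integral_unique:
  assumes "a \<le> b" "has_young_integral F G a b I"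
  shows "young_integral F G a b = I"
  unfolding young_integral_def
  using assms has_young_integral_unique by blast

text \<open>The integral of \<open>u dh\<close> along a path \<open>\<gamma>\<close> parametrised by \<open>[0, T]\<close>.\<close>

definition path_young_integrable ::
    "(real \<Rightarrow> 'v) \<Rightarrow> real \<Rightarrow> ('v \<Rightarrow> complex) \<Rightarrow> ('v \<Rightarrow> complex) \<Rightarrow> bool" where
  "path_young_integrable \<gamma> T u h \<longleftrightarrow> young_integrable (u \<circ> \<gamma>) (h \<circ> \<gamma>) 0 T"

definition path_young_integral ::
    "(real \<Rightarrow> 'v) \<Rightarrow> real \<Rightarrow> ('v \<Rightarrow> complex) \<Rightarrow> ('v \<Rightarrow> complex) \<Rightarrow> complex" where
  "path_young_integral \<gamma> T u h = young_integral (u \<circ> \<gamma>) (h \<circ> \<gamma>) 0 T"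

definition continuous_log_branch :: "(complex \<Rightarrow> complex) \<Rightarrow> complex set \<Rightarrow> bool" where
  "continuous_log_branch Log C \<longleftrightarrow> continuous_on C Log \<and> (\<forall>z\<in>C. exp (Log z) = z)"

definition branch_power :: "(complex \<Rightarrow> complex) \<Rightarrow> complex \<Rightarrow> complex \<Rightarrow> complex" where
  "branch_power Log z s = exp (s * Log z)"

lemma branch_power_of_nat:
  assumes "continuous_log_branch Log C" "z \<in> C"
  shows "branch_power Log z (of_nat k) = z ^ k"
  using assms unfolding branch_power_def continuous_log_branch_def exp_of_nat_mult by simp

end

theory Submission
  imports Defs
begin

text \<open>
  The condition \<open>\<bar>log z\<bar> < log 2\<close> puts \<open>f(S)\<close> into a disc \<open>\<bar>z - 1\<bar> \<le> r\<close> with \<open>r < 1\<close>, since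
  \<open>\<bar>exp w - 1\<bar> \<le> exp \<bar>w\<bar> - 1\<close> (\<open>norm_exp_minus_one_le\<close>). It also makes the given branch the principal
  one on \<open>f(S)\<close>. By the binomial theorem the inner sum is \<open>\<integral> (1 - f)\<^sup>n g dh\<close>, so the series is the
  binomial expansion of \<open>f\<^sup>s = (1 + (f - 1))\<^sup>s\<close> integrated term by term, and the point is to
  exchange the sum with the Young integral.

  Uniform convergence of the integrands does not suffice for that: the Young integral is not
  continuous for the sup norm. It is continuous for the sup norm together with the Lipschitz
  constant, \<open>\<bar>\<integral> u dh\<bar> \<le> C (M + L)\<close> if \<open>u\<close> is bounded by \<open>M\<close> and \<open>L\<close>-Lipschitz
  (\<open>path_young_integral_bound\<close>). Inside the disc of radius \<open>r\<close> the remainders of the binomial series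
  tend to \<open>0\<close> in this stronger sense, because the differentiated series converges absolutely there
  as well (\<open>binomial_remainder_tendsto_zero\<close>); multiplication by \<open>g\<close> and composition with \<open>f\<close> keep
  this property.

  The bound on the integral is Young's theory. The \<open>p\<close>-variation gives a monotone function \<open>V\<close> of
  time with \<open>\<bar>\<gamma> t - \<gamma> s\<bar>\<^sup>p \<le> V t - V s\<close>. Removing a point from a subdivision changes the
  Riemann--Stieltjes sum by a product of two increments, hence by at most
  \<open>\<epsilon> (V t - V s)\<^sup>\<alpha>\<close> with an exponent \<open>\<alpha> > 1\<close>, as \<open>p < 2\<close>. Such errors can be summed
  independently of the number of points (\<open>discrete_sewing\<close>). This bounds the sums for
  \<open>\<alpha> = 2 / p\<close>; for a slightly smaller \<open>\<alpha>\<close>, uniform continuity of the path lets \<open>\<epsilon>\<close> tend to \<open>0\<close>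
  with the mesh, which makes the sums Cauchy.
\<close>

section \<open>A control function for the p-variation\<close>

text \<open>\<open>V t\<close> is the \<open>p\<close>-variation over \<open>[a, t]\<close>: appending the point \<open>t\<close> to a subdivision of \<open>[a, s]\<close>
  adds the single term \<open>\<bar>x t - x s\<bar>\<^sup>p\<close> to its sum. Differences \<open>V t - V s\<close> are additive, which spares
  the superadditivity of the variation over subintervals.\<close>

lemma p_variation_control:
  fixes x :: "real \<Rightarrow> 'a::metric_space"
  assumes "finite_p_variation p a b x"
  obtains V :: "real \<Rightarrow> real"
  where "\<And>s t. a \<le> s \<Longrightarrow> s \<le> t \<Longrightarrow> t \<le> b \<Longrightarrow> dist (x s) (x t) powr p \<le> V t - V s"
proof -
  define P where
    "P t = {\<Sum>i<n. dist (x (u i)) (x (u (Suc i))) powr p | n u. subdivision a t n u}" for t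
  have append: "y + dist (x s) (x t) powr p \<in> P t" if y: "y \<in> P s" and "s \<le> t" for s t y
  proof -
    obtain n u where u: "subdivision a s n u"
      "y = (\<Sum>i<n. dist (x (u i)) (x (u (Suc i))) powr p)"
      using y by (auto simp: P_def)
    define u' where "u' = u(Suc n := t)"
    have "subdivision a t (Suc n) u'"
      using u(1) \<open>s \<le> t\<close> by (auto simp: subdivision_def u'_def less_Suc_eq)
    moreover have "(\<Sum>i<Suc n. dist (x (u' i)) (x (u' (Suc i))) powr p)
        = y + dist (x s) (x t) powr p"
      using u by (simp add: u'_def subdivision_def)
    ultimately show ?thesis unfolding P_def
      by (intro CollectI exI[of _ "Suc n"] exI[of _ u']) simp
  qed
  have "0 \<in> P a"
    unfolding P_def by (rule CollectI, rule exI[of _ 0], rule exI[of _ "\<lambda>_. a"])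
      (simp add: subdivision_def)
  then have ne: "P s \<noteq> {}" if "a \<le> s" for s using append that by blast
  have bdd: "bdd_above (P s)" if "s \<le> b" for s
  proof -
    obtain M where M: "\<And>y. y \<in> P b \<Longrightarrow> y \<le> M"
      using assms unfolding finite_p_variation_def P_def[symmetric] bdd_above_def by blast
    have "y \<le> M" if "y \<in> P s" for y
    proof -
      have "y \<le> y + dist (x s) (x b) powr p" by simp
      also have "\<dots> \<le> M" using M append that \<open>s \<le> b\<close> by blast
      finally show ?thesis .
    qed
    then show ?thesis by (auto simp: bdd_above_def)
  qed
  show ?thesis
  proof (rule that[of "\<lambda>t. Sup (P t)"])
    fix s t assume st: "a \<le> s" "s \<le> t" "t \<le> b"
    have "Sup (P s) \<le> Sup (P t) - dist (x s) (x t) powr p"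
    proof (rule cSup_least[OF ne[OF st(1)]])
      fix y assume "y \<in> P s"
      then have "y + dist (x s) (x t) powr p \<le> Sup (P t)"
        using append st bdd by (intro cSup_upper) auto
      then show "y \<le> Sup (P t) - dist (x s) (x t) powr p" by simp
    qed
    then show "dist (x s) (x t) powr p \<le> Sup (P t) - Sup (P s)" by simp
  qed
qed

section \<open>Discrete sewing\<close>

text \<open>The solution of \<open>K = 2 * K * (1 / 2)\<^sup>\<alpha> + 2\<close>, the equation that closes the induction in
  \<open>discrete_sewing\<close>.\<close>

definition sewing_constant :: "real \<Rightarrow> real" where
  "sewing_constant \<alpha> = 2 / (1 - 2 powr (1 - \<alpha>))"

lemma sewing_constant:
  assumes "\<alpha> > 1"
  shows "sewing_constant \<alpha> \<ge> 0"
    and "sewing_constant \<alpha> * 2 powr (1 - \<alpha>) + 2 = sewing_constant \<alpha>"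
proof -
  have "2 powr (1 - \<alpha>) < 2 powr (0::real)" using assms by (intro powr_less_mono) auto
  then have pos: "1 - 2 powr (1 - \<alpha>) > 0" by simp
  then show "sewing_constant \<alpha> \<ge> 0" by (simp add: sewing_constant_def)
  show "sewing_constant \<alpha> * 2 powr (1 - \<alpha>) + 2 = sewing_constant \<alpha>"
    using pos assms by (simp add: sewing_constant_def field_simps)
qed

text \<open>Bisection: split the index range at a step \<open>j, j + 1\<close> such that \<open>V\<close> grows by at most half of its
  total growth on either side of the step. Each side contributes at most \<open>K \<epsilon> (w / 2)\<^sup>\<alpha>\<close> by induction,
  and the two cuts cost \<open>2 \<epsilon> w\<^sup>\<alpha>\<close>. Since \<open>\<alpha> > 1\<close>, two halves together weigh less than the whole, so
  the constant \<open>K\<close> reproduces itself and does not depend on the number of points.\<close>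

lemma discrete_sewing:
  fixes A :: "nat \<Rightarrow> nat \<Rightarrow> 'a::real_normed_vector" and V :: "nat \<Rightarrow> real"
  assumes "\<alpha> > 1" and "\<epsilon> \<ge> 0" and "m \<le> n"
    and "mono_on {m..n} V"
    and "\<And>i. A i i = 0"
    and "\<And>i j k. m \<le> i \<Longrightarrow> i \<le> j \<Longrightarrow> j \<le> k \<Longrightarrow> k \<le> n \<Longrightarrow>
           norm (A i k - A i j - A j k) \<le> \<epsilon> * (V k - V i) powr \<alpha>"
  shows "norm ((\<Sum>i=m..<n. A i (Suc i)) - A m n)
           \<le> sewing_constant \<alpha> * \<epsilon> * (V n - V m) powr \<alpha>"
  using assms(3,4,6)
proof (induction "n - m" arbitrary: m n rule: less_induct)
  case less
  let ?K = "sewing_constant \<alpha>" and ?S = "\<lambda>m n. \<Sum>i=m..<n. A i (Suc i)"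
  have V_le: "V i \<le> V j" if "m \<le> i" "i \<le> j" "j \<le> n" for i j
    using less.prems(2) that by (auto intro: mono_onD)
  have V_mono: "mono_on {i..j} V" if "m \<le> i" "j \<le> n" for i j
    using that by (intro mono_on_subset[OF less.prems(2)]) auto
  show ?case
  proof (cases "m = n")
    case True
    then show ?thesis by (simp add: assms(5))
  next
    case False
    then have "m < n" using less.prems by simp
    define w where "w = V n - V m"
    have w: "0 \<le> w" using V_le[of m n] \<open>m < n\<close> by (simp add: w_def)
    define J where "J = {j \<in> {m..<n}. V j - V m \<le> w / 2}"
    define j where "j = Max J"
    have J: "finite J" "m \<in> J" using \<open>m < n\<close> w by (auto simp: J_def)
    have "j \<in> J" unfolding j_def using J by (intro Max_in) auto
    then have j: "m \<le> j" "j < n" "V j - V m \<le> w / 2" by (auto simp: J_def)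
    have right: "V n - V (Suc j) \<le> w / 2"
    proof (cases "Suc j = n")
      case True
      then show ?thesis using w by simp
    next
      case False
      have "Suc j \<notin> J" using Max_ge[OF J(1), of "Suc j"] by (auto simp: j_def)
      then have "V (Suc j) - V m > w / 2" using False j by (auto simp: J_def)
      then show ?thesis by (simp add: w_def field_simps)
    qed
    have half: "?K * \<epsilon> * v powr \<alpha> \<le> ?K * \<epsilon> * (w / 2) powr \<alpha>" if "0 \<le> v" "v \<le> w / 2" for v
      using that \<open>\<alpha> > 1\<close> \<open>\<epsilon> \<ge> 0\<close> sewing_constant(1)[OF \<open>\<alpha> > 1\<close>]
      by (intro mult_left_mono powr_mono2 mult_nonneg_nonneg) auto
    have "norm (?S m j - A m j) \<le> ?K * \<epsilon> * (V j - V m) powr \<alpha>"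
      using j less.prems(3) V_mono by (intro less.hyps) auto
    also have "\<dots> \<le> ?K * \<epsilon> * (w / 2) powr \<alpha>" using j V_le[of m j] by (intro half) auto
    finally have 1: "norm (?S m j - A m j) \<le> ?K * \<epsilon> * (w / 2) powr \<alpha>" .
    have "norm (?S (Suc j) n - A (Suc j) n) \<le> ?K * \<epsilon> * (V n - V (Suc j)) powr \<alpha>"
      using j less.prems(3) V_mono by (intro less.hyps) auto
    also have "\<dots> \<le> ?K * \<epsilon> * (w / 2) powr \<alpha>"
      using j right V_le[of "Suc j" n] by (intro half) auto
    finally have 2: "norm (?S (Suc j) n - A (Suc j) n) \<le> ?K * \<epsilon> * (w / 2) powr \<alpha>" .
    have 3: "norm (A m n - A m j - A j n) \<le> \<epsilon> * w powr \<alpha>"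
      using less.prems(3)[of m j n] j by (simp add: w_def)
    have "norm (A j n - A j (Suc j) - A (Suc j) n) \<le> \<epsilon> * (V n - V j) powr \<alpha>"
      using less.prems(3)[of j "Suc j" n] j by simp
    also have "\<dots> \<le> \<epsilon> * w powr \<alpha>"
      using \<open>\<epsilon> \<ge> 0\<close> \<open>\<alpha> > 1\<close> V_le[of m j] V_le[of j n] j
      by (intro mult_left_mono powr_mono2) (auto simp: w_def)
    finally have 4: "norm (A j n - A j (Suc j) - A (Suc j) n) \<le> \<epsilon> * w powr \<alpha>" .
    have "?S m n = ?S m j + A j (Suc j) + ?S (Suc j) n"
      using j sum.atLeastLessThan_concat[of m j n "\<lambda>i. A i (Suc i)"]
        sum.atLeast_Suc_lessThan[of j n "\<lambda>i. A i (Suc i)"]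
      by (simp add: add.assoc)
    then have "?S m n - A m n = (?S m j - A m j) + (?S (Suc j) n - A (Suc j) n)
        - (A m n - A m j - A j n) - (A j n - A j (Suc j) - A (Suc j) n)"
      by (simp add: algebra_simps)
    also have "norm \<dots> \<le> 2 * (?K * \<epsilon> * (w / 2) powr \<alpha>) + 2 * (\<epsilon> * w powr \<alpha>)"
      using 1 2 3 4
        norm_triangle_ineq[of "?S m j - A m j" "?S (Suc j) n - A (Suc j) n"]
        norm_triangle_ineq4[of "(?S m j - A m j) + (?S (Suc j) n - A (Suc j) n)"
          "A m n - A m j - A j n"]
        norm_triangle_ineq4[of "(?S m j - A m j) + (?S (Suc j) n - A (Suc j) n)
          - (A m n - A m j - A j n)" "A j n - A j (Suc j) - A (Suc j) n"]
      by linarith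
    also have "\<dots> = (?K * 2 powr (1 - \<alpha>) + 2) * \<epsilon> * w powr \<alpha>"
      using w by (simp add: powr_divide powr_diff algebra_simps)
    also have "\<dots> = ?K * \<epsilon> * w powr \<alpha>"
      by (simp only: sewing_constant(2)[OF \<open>\<alpha> > 1\<close>])
    finally show ?thesis by (simp add: w_def)
  qed
qed

section \<open>Comparing Riemann--Stieltjes sums\<close>

lemma subdivision_mono:
  assumes "subdivision a b n t" "i \<le> j" "j \<le> n"
  shows "t i \<le> t j"
  using assms(2,3)
proof (induction j rule: dec_induct)
  case (step k)
  then show ?case using assms(1) unfolding subdivision_def by (meson Suc_le_lessD Suc_leD order_trans)
qed simp

lemma subdivision_mem:
  assumes "subdivision a b n t" "i \<le> n"
  shows "t i \<in> {a..b}"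
  using subdivision_mono[OF assms(1), of 0 i] subdivision_mono[OF assms(1), of i n] assms
  by (auto simp: subdivision_def)

text \<open>The sewing lemma applied to \<open>A i j = F (c i) * (G (c j) - G (c i))\<close>, whose defect is a product of
  an increment of \<open>F\<close> and an increment of \<open>G\<close>; moving the tag from \<open>s\<close> to \<open>\<xi>\<close> costs one more such
  product, hence the \<open>1 +\<close> in the constant. The tags \<open>u\<close> and \<open>v\<close> in the hypothesis are independent
  in order to cover both uses.\<close>

lemma riemann_sum_refine_interval:
  fixes F G :: "real \<Rightarrow> complex"
  assumes "\<alpha> > 1" and "\<epsilon> \<ge> 0"
    and "mono_on {s..t} V"
    and bound: "\<And>x y u v. s \<le> x \<Longrightarrow> y \<le> t \<Longrightarrow> u \<in> {x..y} \<Longrightarrow> v \<in> {x..y} \<Longrightarrow>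
           cmod (F u - F x) * cmod (G y - G v) \<le> \<epsilon> * (V y - V x) powr \<alpha>"
    and c: "subdivision s t m c"
    and \<xi>: "\<xi> \<in> {s..t}"
  shows "cmod (F \<xi> * (G t - G s) - (\<Sum>j<m. F (c j) * (G (c (Suc j)) - G (c j))))
           \<le> (1 + sewing_constant \<alpha>) * \<epsilon> * (V t - V s) powr \<alpha>"
proof -
  define A where "A i j = F (c i) * (G (c j) - G (c i))" for i j
  have c_mem: "c i \<in> {s..t}" if "i \<le> m" for i using subdivision_mem[OF c that] .
  have "cmod ((\<Sum>i=0..<m. A i (Suc i)) - A 0 m)
      \<le> sewing_constant \<alpha> * \<epsilon> * (V (c m) - V (c 0)) powr \<alpha>"
  proof (rule discrete_sewing[OF assms(1,2), where V = "\<lambda>i. V (c i)"])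
    show "mono_on {0..m} (\<lambda>i. V (c i))"
      by (rule mono_onI, rule mono_onD[OF assms(3)]) (use c_mem subdivision_mono[OF c] in auto)
    fix i j k assume ijk: "i \<le> j" "j \<le> k" "k \<le> m"
    have "A i k - A i j - A j k = - ((F (c j) - F (c i)) * (G (c k) - G (c j)))"
      by (simp add: A_def algebra_simps)
    then have "cmod (A i k - A i j - A j k) = cmod (F (c j) - F (c i)) * cmod (G (c k) - G (c j))"
      by (simp add: norm_mult)
    also have "\<dots> \<le> \<epsilon> * (V (c k) - V (c i)) powr \<alpha>"
      using ijk c_mem[of i] c_mem[of k] subdivision_mono[OF c, of i j] subdivision_mono[OF c, of j k]
      by (intro bound[of "c i" "c k" "c j" "c j"]) auto
    finally show "cmod (A i k - A i j - A j k) \<le> \<epsilon> * (V (c k) - V (c i)) powr \<alpha>" .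
  qed (auto simp: A_def)
  then have 1: "cmod ((\<Sum>j<m. F (c j) * (G (c (Suc j)) - G (c j))) - F s * (G t - G s))
      \<le> sewing_constant \<alpha> * \<epsilon> * (V t - V s) powr \<alpha>"
    using c by (simp add: A_def subdivision_def atLeast0LessThan)
  have "cmod ((F \<xi> - F s) * (G t - G s)) \<le> \<epsilon> * (V t - V s) powr \<alpha>"
    using bound[of s t \<xi> s] \<xi> by (simp add: norm_mult)
  moreover have "F \<xi> * (G t - G s) - (\<Sum>j<m. F (c j) * (G (c (Suc j)) - G (c j)))
      = (F \<xi> - F s) * (G t - G s)
        - ((\<Sum>j<m. F (c j) * (G (c (Suc j)) - G (c j))) - F s * (G t - G s))"
    by (simp add: algebra_simps)
  ultimately show ?thesis
    using 1 norm_triangle_ineq4[of "(F \<xi> - F s) * (G t - G s)"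
      "(\<Sum>j<m. F (c j) * (G (c (Suc j)) - G (c j))) - F s * (G t - G s)"]
    by (simp add: algebra_simps)
qed

text \<open>Clamping the points of one subdivision to the cells of another one yields their common
  refinement, without any sorting: repeated points are allowed and contribute nothing.\<close>

definition clamp_to :: "real \<Rightarrow> real \<Rightarrow> real \<Rightarrow> real" where
  "clamp_to l r x = max l (min r x)"

lemma subdivision_clamp_to:
  assumes "subdivision a b m c" "a \<le> l" "l \<le> r" "r \<le> b"
  shows "subdivision l r m (\<lambda>j. clamp_to l r (c j))"
  using assms by (fastforce simp: subdivision_def clamp_to_def)

text \<open>The two ways to form the common refinement have the same cells: both sides stand for the
  intersection of \<open>[l, r]\<close> and \<open>[l', r']\<close>, or for a degenerate interval if it is empty.\<close>

lemma clamp_to_cell: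
  fixes A :: "real \<Rightarrow> real \<Rightarrow> 'a::zero"
  assumes "\<And>x. A x x = 0" "l \<le> r" "l' \<le> r'"
  shows "A (clamp_to l r l') (clamp_to l r r') = A (clamp_to l' r' l) (clamp_to l' r' r)"
proof -
  consider "r \<le> l'" | "r' \<le> l" | "l' < r" "l < r'" by linarith
  then show ?thesis
  proof cases
    case 1
    then have "clamp_to l r l' = r" "clamp_to l r r' = r"
      "clamp_to l' r' l = l'" "clamp_to l' r' r = l'"
      using assms(2,3) by (simp_all add: clamp_to_def)
    then show ?thesis by (simp add: assms(1))
  next
    case 2
    then have "clamp_to l r l' = l" "clamp_to l r r' = l"
      "clamp_to l' r' l = r'" "clamp_to l' r' r = r'"
      using assms(2,3) by (simp_all add: clamp_to_def)
    then show ?thesis by (simp add: assms(1))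
  next
    case 3
    then have "clamp_to l r l' = clamp_to l' r' l" "clamp_to l r r' = clamp_to l' r' r"
      using assms(2,3) by (simp_all add: clamp_to_def max_def min_def)
    then show ?thesis by simp
  qed
qed

lemma sum_powr_increments_le:
  fixes V :: "real \<Rightarrow> real"
  assumes "\<alpha> \<ge> 1" "mono_on {a..b} V" "subdivision a b n t"
  shows "(\<Sum>i<n. (V (t (Suc i)) - V (t i)) powr \<alpha>) \<le> (V b - V a) powr \<alpha>"
proof -
  define M where "M = V b - V a"
  have V_le: "V x \<le> V y" if "a \<le> x" "x \<le> y" "y \<le> b" for x y
    using assms(2) that by (auto intro: mono_onD)
  have "(V (t (Suc i)) - V (t i)) powr \<alpha> \<le> (V (t (Suc i)) - V (t i)) * M powr (\<alpha> - 1)"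
    if "i < n" for i
  proof -
    let ?x = "V (t (Suc i)) - V (t i)"
    have t: "a \<le> t i" "t i \<le> t (Suc i)" "t (Suc i) \<le> b"
      using subdivision_mem[OF assms(3), of i] subdivision_mem[OF assms(3), of "Suc i"]
        assms(3) that by (auto simp: subdivision_def)
    then have x: "0 \<le> ?x" "?x \<le> M"
      using V_le[of "t i" "t (Suc i)"] V_le[of a "t i"] V_le[of "t (Suc i)" b] by (auto simp: M_def)
    have "?x powr \<alpha> = ?x * ?x powr (\<alpha> - 1)"
      using x powr_mult_base[of ?x "\<alpha> - 1"] by simp
    also have "\<dots> \<le> ?x * M powr (\<alpha> - 1)"
      using x assms(1) by (intro mult_left_mono powr_mono2) auto
    finally show ?thesis .
  qed
  then have "(\<Sum>i<n. (V (t (Suc i)) - V (t i)) powr \<alpha>)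
      \<le> (\<Sum>i<n. (V (t (Suc i)) - V (t i)) * M powr (\<alpha> - 1))"
    by (intro sum_mono) auto
  also have "\<dots> = M * M powr (\<alpha> - 1)"
    using assms(3) sum_lessThan_telescope[of "\<lambda>i. V (t i)" n]
    by (simp add: sum_distrib_right[symmetric] subdivision_def M_def)
  also have "\<dots> = M powr \<alpha>"
  proof -
    have "a \<le> b" using subdivision_mem[OF assms(3), of 0] by auto
    then show ?thesis using powr_mult_base[of M "\<alpha> - 1"] V_le[of a b] by (simp add: M_def)
  qed
  finally show ?thesis by (simp add: M_def)
qed

definition tagged_sum ::
    "(real \<Rightarrow> complex) \<Rightarrow> (real \<Rightarrow> complex) \<Rightarrow> nat \<times> (nat \<Rightarrow> real) \<times> (nat \<Rightarrow> real) \<Rightarrow> complex" where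
  "tagged_sum F G = (\<lambda>(n, t, \<xi>). \<Sum>i<n. F (\<xi> i) * (G (t (Suc i)) - G (t i)))"

definition fine_tagged_subdivisions ::
    "real \<Rightarrow> real \<Rightarrow> real \<Rightarrow> (nat \<times> (nat \<Rightarrow> real) \<times> (nat \<Rightarrow> real)) set" where
  "fine_tagged_subdivisions a b d = {(n, t, \<xi>). subdivision a b n t \<and>
     (\<forall>i<n. t (Suc i) - t i < d) \<and> (\<forall>i<n. \<xi> i \<in> {t i..t (Suc i)})}"

text \<open>Both sums are compared with the sum over the common refinement \<open>R\<close>: cell by cell with
  \<open>riemann_sum_refine_interval\<close>, the cellwise errors being summed by \<open>sum_powr_increments_le\<close>.\<close>

lemma tagged_sums_close:
  fixes F G :: "real \<Rightarrow> complex"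
  assumes "\<alpha> > 1" and "\<epsilon> \<ge> 0"
    and V: "mono_on {a..b} V"
    and bound: "\<And>x y u v. a \<le> x \<Longrightarrow> y \<le> b \<Longrightarrow> y - x < d \<Longrightarrow> u \<in> {x..y} \<Longrightarrow> v \<in> {x..y} \<Longrightarrow>
           cmod (F u - F x) * cmod (G y - G v) \<le> \<epsilon> * (V y - V x) powr \<alpha>"
    and D: "D \<in> fine_tagged_subdivisions a b d" and D': "D' \<in> fine_tagged_subdivisions a b d"
  shows "cmod (tagged_sum F G D - tagged_sum F G D')
           \<le> 2 * ((1 + sewing_constant \<alpha>) * \<epsilon> * (V b - V a) powr \<alpha>)"
proof -
  let ?B = "(1 + sewing_constant \<alpha>) * \<epsilon>"
  define A where "A x y = F x * (G y - G x)" for x y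
  define R where "R n t m c = (\<Sum>i<n. \<Sum>j<m. A (clamp_to (t i) (t (Suc i)) (c j))
      (clamp_to (t i) (t (Suc i)) (c (Suc j))))" for n m :: nat and t c
  have to_refinement: "cmod (tagged_sum F G (n, t, \<xi>) - R n t m c) \<le> ?B * (V b - V a) powr \<alpha>"
    if nt: "(n, t, \<xi>) \<in> fine_tagged_subdivisions a b d" and c: "subdivision a b m c" for n t \<xi> m c
  proof -
    have t: "subdivision a b n t" using nt by (simp add: fine_tagged_subdivisions_def)
    have "cmod (F (\<xi> i) * (G (t (Suc i)) - G (t i))
        - (\<Sum>j<m. A (clamp_to (t i) (t (Suc i)) (c j)) (clamp_to (t i) (t (Suc i)) (c (Suc j)))))
        \<le> ?B * (V (t (Suc i)) - V (t i)) powr \<alpha>" if "i < n" for i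
      unfolding A_def
    proof (rule riemann_sum_refine_interval[OF assms(1,2)])
      have ti: "a \<le> t i" "t i \<le> t (Suc i)" "t (Suc i) \<le> b"
        using subdivision_mem[OF t, of i] subdivision_mem[OF t, of "Suc i"] t that
        by (auto simp: subdivision_def)
      show "mono_on {t i..t (Suc i)} V" using V ti by (auto intro: mono_on_subset)
      show "subdivision (t i) (t (Suc i)) m (\<lambda>j. clamp_to (t i) (t (Suc i)) (c j))"
        using subdivision_clamp_to[OF c] ti by simp
      show "\<xi> i \<in> {t i..t (Suc i)}" using nt that by (simp add: fine_tagged_subdivisions_def)
      have "t (Suc i) - t i < d" using nt that by (simp add: fine_tagged_subdivisions_def)
      then show "cmod (F u - F x) * cmod (G y - G v) \<le> \<epsilon> * (V y - V x) powr \<alpha>"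
        if "t i \<le> x" "y \<le> t (Suc i)" "u \<in> {x..y}" "v \<in> {x..y}" for x y u v
        using that ti by (intro bound) auto
    qed
    then have "cmod (tagged_sum F G (n, t, \<xi>) - R n t m c)
        \<le> (\<Sum>i<n. ?B * (V (t (Suc i)) - V (t i)) powr \<alpha>)"
      unfolding tagged_sum_def R_def prod.case sum_subtractf[symmetric] by (intro sum_norm_le) auto
    also have "\<dots> \<le> ?B * (V b - V a) powr \<alpha>"
      unfolding sum_distrib_left[symmetric]
      using sum_powr_increments_le[OF _ V t, of \<alpha>] assms(1,2) sewing_constant(1)[OF assms(1)]
      by (intro mult_left_mono) auto
    finally show ?thesis .
  qed
  obtain n t \<xi> m c \<eta> where eqs: "D = (n, t, \<xi>)" "D' = (m, c, \<eta>)"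
    using prod_cases3 by metis
  have t: "subdivision a b n t" and c: "subdivision a b m c"
    using D D' by (auto simp: eqs fine_tagged_subdivisions_def)
  have "R m c n t = R n t m c"
    unfolding R_def
    by (subst sum.swap, intro sum.cong refl clamp_to_cell)
      (use t c in \<open>auto simp: subdivision_def A_def\<close>)
  then have "cmod (tagged_sum F G D - R n t m c) \<le> ?B * (V b - V a) powr \<alpha>"
    "cmod (tagged_sum F G D' - R n t m c) \<le> ?B * (V b - V a) powr \<alpha>"
    using to_refinement[of n t \<xi> m c] to_refinement[of m c \<eta> n t] D D' t c by (simp_all add: eqs)
  then show ?thesis
    using norm_triangle_ineq4[of "tagged_sum F G D - R n t m c" "tagged_sum F G D' - R n t m c"]
    by simp
qed

section \<open>Young integrals as limits along a filter\<close>

text \<open>The filter of vanishing mesh reduces the linearity of the integral and its existence by a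
  Cauchy criterion to general facts on limits.\<close>

definition tagged_filter ::
    "real \<Rightarrow> real \<Rightarrow> (nat \<times> (nat \<Rightarrow> real) \<times> (nat \<Rightarrow> real)) filter" where
  "tagged_filter a b = (INF d\<in>{0<..}. principal (fine_tagged_subdivisions a b d))"

lemma eventually_tagged_filter:
  "eventually P (tagged_filter a b) \<longleftrightarrow> (\<exists>d>0. \<forall>D\<in>fine_tagged_subdivisions a b d. P D)"
proof -
  have "\<exists>d\<in>{0<..}. principal (fine_tagged_subdivisions a b d)
      \<le> inf (principal (fine_tagged_subdivisions a b d1)) (principal (fine_tagged_subdivisions a b d2))"
    if "d1 \<in> {0<..}" "d2 \<in> {0<..}" for d1 d2 :: real
    using that by (intro bexI[of _ "min d1 d2"]) (auto simp: fine_tagged_subdivisions_def)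
  then show ?thesis
    unfolding tagged_filter_def
    by (subst eventually_INF_base) (auto simp: eventually_principal intro: exI[of _ 1])
qed

lemma tagged_filter_neq_bot:
  assumes "a \<le> b"
  shows "tagged_filter a b \<noteq> bot"
proof -
  have "\<exists>D. D \<in> fine_tagged_subdivisions a b d" if d: "d > 0" for d
  proof -
    obtain n t where "subdivision a b n t" "\<And>i. i < n \<Longrightarrow> t (Suc i) - t i < d"
      using subdivision_fine_exists[OF assms d] by blast
    then have "(n, t, t) \<in> fine_tagged_subdivisions a b d"
      by (auto simp: fine_tagged_subdivisions_def subdivision_def)
    then show ?thesis ..
  qed
  then have "\<not> eventually (\<lambda>_. False) (tagged_filter a b)"
    unfolding eventually_tagged_filter by blast
  then show ?thesis by (auto simp: trivial_limit_def)
qed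

lemma has_young_integral_iff_tendsto:
  "has_young_integral F G a b I \<longleftrightarrow> (tagged_sum F G \<longlongrightarrow> I) (tagged_filter a b)"
  unfolding has_young_integral_def tendsto_iff eventually_tagged_filter
  by (auto simp: fine_tagged_subdivisions_def tagged_sum_def dist_norm)

lemma has_young_integral_cmult:
  assumes "has_young_integral F G a b I"
  shows "has_young_integral (\<lambda>x. c * F x) G a b (c * I)"
proof -
  have "tagged_sum (\<lambda>x. c * F x) G = (\<lambda>D. c * tagged_sum F G D)"
    by (auto simp: tagged_sum_def fun_eq_iff sum_distrib_left mult.assoc)
  then show ?thesis
    using assms unfolding has_young_integral_iff_tendsto by (simp add: tendsto_mult_left)
qed

lemma has_young_integral_diff:
  assumes "has_young_integral F G a b I" "has_young_integral F' G a b I'"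
  shows "has_young_integral (\<lambda>x. F x - F' x) G a b (I - I')"
proof -
  have "tagged_sum (\<lambda>x. F x - F' x) G = (\<lambda>D. tagged_sum F G D - tagged_sum F' G D)"
    by (auto simp: tagged_sum_def fun_eq_iff sum_subtractf left_diff_distrib)
  then show ?thesis
    using assms unfolding has_young_integral_iff_tendsto by (simp add: tendsto_diff)
qed

lemma has_young_integral_sum:
  assumes "\<And>k. k \<in> K \<Longrightarrow> has_young_integral (F k) G a b (I k)"
  shows "has_young_integral (\<lambda>x. \<Sum>k\<in>K. F k x) G a b (\<Sum>k\<in>K. I k)"
proof -
  have "tagged_sum (\<lambda>x. \<Sum>k\<in>K. F k x) G = (\<lambda>D. \<Sum>k\<in>K. tagged_sum (F k) G D)"
    by (auto simp: tagged_sum_def fun_eq_iff sum_distrib_right intro: sum.swap)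
  then show ?thesis
    using assms unfolding has_young_integral_iff_tendsto by (simp add: tendsto_sum)
qed

section \<open>Young's existence theorem and inequality\<close>

text \<open>Two sums of mesh below \<open>d\<close> differ by at most a fixed multiple of \<open>\<epsilon>\<close>, so the sums form a Cauchy
  filter.\<close>

lemma young_integrableI:
  fixes F G :: "real \<Rightarrow> complex"
  assumes "a \<le> b" and \<alpha>: "\<alpha> > 1" and V: "mono_on {a..b} V"
    and bound: "\<And>\<epsilon>. \<epsilon> > 0 \<Longrightarrow> \<exists>d>0. \<forall>x y u v. a \<le> x \<longrightarrow> y \<le> b \<longrightarrow> y - x < d \<longrightarrow>
           u \<in> {x..y} \<longrightarrow> v \<in> {x..y} \<longrightarrow>
           cmod (F u - F x) * cmod (G y - G v) \<le> \<epsilon> * (V y - V x) powr \<alpha>"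
  shows "young_integrable F G a b"
proof -
  let ?\<Phi> = "filtermap (tagged_sum F G) (tagged_filter a b)"
  define C where "C = 2 * ((1 + sewing_constant \<alpha>) * (V b - V a) powr \<alpha>)"
  have "C \<ge> 0" using sewing_constant(1)[OF \<alpha>] by (simp add: C_def)
  have "cauchy_filter ?\<Phi>"
    unfolding cauchy_filter_metric_filtermap
  proof (intro allI impI)
    fix e :: real assume "e > 0"
    define \<epsilon> where "\<epsilon> = e / (C + 1)"
    have "\<epsilon> > 0" using \<open>e > 0\<close> \<open>C \<ge> 0\<close> by (simp add: \<epsilon>_def)
    obtain d where d: "d > 0"
      "\<And>x y u v. a \<le> x \<Longrightarrow> y \<le> b \<Longrightarrow> y - x < d \<Longrightarrow> u \<in> {x..y} \<Longrightarrow> v \<in> {x..y} \<Longrightarrow>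
           cmod (F u - F x) * cmod (G y - G v) \<le> \<epsilon> * (V y - V x) powr \<alpha>"
      using bound[OF \<open>\<epsilon> > 0\<close>] by blast
    have "dist (tagged_sum F G D) (tagged_sum F G D') < e"
      if "D \<in> fine_tagged_subdivisions a b d" "D' \<in> fine_tagged_subdivisions a b d" for D D'
    proof -
      have "dist (tagged_sum F G D) (tagged_sum F G D') \<le> C * \<epsilon>"
        using tagged_sums_close[OF \<alpha> less_imp_le[OF \<open>\<epsilon> > 0\<close>] V d(2) that]
        by (simp add: dist_norm C_def mult_ac)
      also have "\<dots> < e"
        using \<open>e > 0\<close> \<open>C \<ge> 0\<close> by (simp add: \<epsilon>_def field_simps)
      finally show ?thesis .
    qed
    then show "\<exists>P. eventually P (tagged_filter a b) \<and>
        (\<forall>D D'. P D \<and> P D' \<longrightarrow> dist (tagged_sum F G D) (tagged_sum F G D') < e)"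
      using d(1) by (intro exI[of _ "\<lambda>D. D \<in> fine_tagged_subdivisions a b d"])
        (auto simp: eventually_tagged_filter)
  qed
  moreover have "?\<Phi> \<noteq> bot" using tagged_filter_neq_bot[OF \<open>a \<le> b\<close>] by (simp add: filtermap_bot_iff)
  ultimately obtain I where "?\<Phi> \<le> nhds I"
    using complete_UNIV[where 'a = complex] unfolding complete_uniform by auto
  then show ?thesis
    unfolding young_integrable_def has_young_integral_iff_tendsto filterlim_def by blast
qed

text \<open>The term \<open>F a * (G b - G a)\<close> is the Riemann--Stieltjes sum of the subdivision with the single
  cell \<open>[a, b]\<close>. As the hypothesis has no restriction on the mesh, it can be compared with all the
  sums that converge to the integral.\<close>

lemma young_inequality:
  fixes F G :: "real \<Rightarrow> complex"
  assumes "a \<le> b" and \<alpha>: "\<alpha> > 1" and "\<epsilon> \<ge> 0" and V: "mono_on {a..b} V"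
    and bound: "\<And>x y u v. a \<le> x \<Longrightarrow> y \<le> b \<Longrightarrow> u \<in> {x..y} \<Longrightarrow> v \<in> {x..y} \<Longrightarrow>
           cmod (F u - F x) * cmod (G y - G v) \<le> \<epsilon> * (V y - V x) powr \<alpha>"
    and I: "has_young_integral F G a b I"
  shows "cmod (F a * (G b - G a) - I) \<le> 2 * ((1 + sewing_constant \<alpha>) * \<epsilon> * (V b - V a) powr \<alpha>)"
proof -
  obtain d :: real where d: "d > b - a" "d > 0" using gt_ex[of "max (b - a) 0"] by auto
  have trivial: "(1, \<lambda>i. if i = 0 then a else b, \<lambda>_. a) \<in> fine_tagged_subdivisions a b d"
    using \<open>a \<le> b\<close> d by (auto simp: fine_tagged_subdivisions_def subdivision_def)
  have "cmod (F a * (G b - G a) - tagged_sum F G D)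
      \<le> 2 * ((1 + sewing_constant \<alpha>) * \<epsilon> * (V b - V a) powr \<alpha>)"
    if "D \<in> fine_tagged_subdivisions a b d" for D
    using tagged_sums_close[OF \<alpha> \<open>\<epsilon> \<ge> 0\<close> V _ trivial that, of F G] bound
    by (simp add: tagged_sum_def)
  then have ev: "eventually (\<lambda>D. cmod (F a * (G b - G a) - tagged_sum F G D)
      \<le> 2 * ((1 + sewing_constant \<alpha>) * \<epsilon> * (V b - V a) powr \<alpha>)) (tagged_filter a b)"
    using d(2) unfolding eventually_tagged_filter by blast
  have "((\<lambda>D. cmod (F a * (G b - G a) - tagged_sum F G D)) \<longlongrightarrow> cmod (F a * (G b - G a) - I))
      (tagged_filter a b)"
    using I unfolding has_young_integral_iff_tendsto
    by (intro tendsto_norm tendsto_diff tendsto_const)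
  then show ?thesis
    using ev tagged_filter_neq_bot[OF \<open>a \<le> b\<close>] by (rule tendsto_upperbound)
qed


text \<open>Interpolation between the two bounds \<open>z \<le> \<delta>\<close> and \<open>z \<le> w\<^bsup>1/p\<^esup>\<close>: the exponent of \<open>w\<close> can be
  lowered from \<open>2 / p\<close> to \<open>\<alpha>\<close> in exchange for a power of \<open>\<delta>\<close>.\<close>

lemma mult_le_control_powr:
  fixes p :: real
  assumes "p > 0" "\<alpha> \<ge> 0" "\<alpha> * p \<le> 2" "0 \<le> x" "x \<le> \<delta>" "0 \<le> y" "y \<le> \<delta>"
    and "x powr p \<le> w" "y powr p \<le> w"
  shows "x * y \<le> \<delta> powr (2 - \<alpha> * p) * w powr \<alpha>"
proof -
  have "0 \<le> w" using assms(8) powr_ge_zero[of x p] by linarith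
  have half: "z \<le> \<delta> powr (1 - \<alpha> * p / 2) * w powr (\<alpha> / 2)"
    if "0 \<le> z" "z \<le> \<delta>" "z powr p \<le> w" for z
  proof -
    have "z = z powr (1 - \<alpha> * p / 2) * (z powr p) powr (\<alpha> / 2)"
      using \<open>0 \<le> z\<close> by (simp add: powr_powr powr_add[symmetric] mult.commute)
    also have "\<dots> \<le> \<delta> powr (1 - \<alpha> * p / 2) * w powr (\<alpha> / 2)"
      using that assms \<open>0 \<le> w\<close> by (intro mult_mono powr_mono2) auto
    finally show ?thesis .
  qed
  have "x * y \<le> (\<delta> powr (1 - \<alpha> * p / 2) * w powr (\<alpha> / 2)) *
      (\<delta> powr (1 - \<alpha> * p / 2) * w powr (\<alpha> / 2))"
    using assms \<open>0 \<le> w\<close> by (intro mult_mono half) auto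
  also have "\<dots> = (\<delta> powr (1 - \<alpha> * p / 2) * \<delta> powr (1 - \<alpha> * p / 2)) *
      (w powr (\<alpha> / 2) * w powr (\<alpha> / 2))"
    by (simp only: mult_ac)
  also have "\<dots> = \<delta> powr (2 - \<alpha> * p) * w powr \<alpha>"
    by (simp add: powr_add[symmetric])
  finally show ?thesis .
qed

lemma has_young_integral_path_young_integral:
  assumes "0 \<le> T" "path_young_integrable \<gamma> T u h"
  shows "has_young_integral (u \<circ> \<gamma>) (h \<circ> \<gamma>) 0 T (path_young_integral \<gamma> T u h)"
  using assms young_integral_unique
  unfolding path_young_integrable_def path_young_integral_def young_integrable_def by metis

text \<open>The constant is independent of \<open>u\<close>. This uniformity is what permits the passage to
  the limit under the integral.\<close>

lemma path_young_integral_bound: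
  fixes \<gamma> :: "real \<Rightarrow> 'v::metric_space" and h :: "'v \<Rightarrow> complex"
  assumes "0 \<le> T" "1 \<le> p" "p < 2"
    and cont: "continuous_on {0..T} \<gamma>"
    and var: "finite_p_variation p 0 T \<gamma>"
    and h: "H-lipschitz_on (\<gamma> ` {0..T}) h"
  obtains C where
    "\<And>u L M. L-lipschitz_on (\<gamma> ` {0..T}) u \<Longrightarrow> (\<And>x. x \<in> \<gamma> ` {0..T} \<Longrightarrow> cmod (u x) \<le> M) \<Longrightarrow>
           path_young_integrable \<gamma> T u h \<and> cmod (path_young_integral \<gamma> T u h) \<le> C * (M + L)"
proof -
  let ?S = "\<gamma> ` {0..T}"
  have H: "0 \<le> H" using h by (rule lipschitz_on_nonneg)
  obtain V :: "real \<Rightarrow> real" where V: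
    "\<And>s t. 0 \<le> s \<Longrightarrow> s \<le> t \<Longrightarrow> t \<le> T \<Longrightarrow> dist (\<gamma> s) (\<gamma> t) powr p \<le> V t - V s"
    using p_variation_control[OF var] by blast
  have V_le: "V s \<le> V t" if "0 \<le> s" "s \<le> t" "t \<le> T" for s t
    using V[OF that] powr_ge_zero[of "dist (\<gamma> s) (\<gamma> t)" p] by linarith
  have V_mono: "mono_on {0..T} V" by (rule mono_onI) (use V_le in auto)
  have product: "cmod ((u \<circ> \<gamma>) r - (u \<circ> \<gamma>) x) * cmod ((h \<circ> \<gamma>) y - (h \<circ> \<gamma>) v)
      \<le> L * H * \<delta> powr (2 - \<alpha> * p) * (V y - V x) powr \<alpha>"
    if u: "L-lipschitz_on ?S u" and x: "0 \<le> x" "y \<le> T" "r \<in> {x..y}" "v \<in> {x..y}"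
      and \<alpha>: "0 \<le> \<alpha>" "\<alpha> * p \<le> 2"
      and \<delta>: "dist (\<gamma> x) (\<gamma> r) \<le> \<delta>" "dist (\<gamma> v) (\<gamma> y) \<le> \<delta>"
    for u L x y r v \<alpha> \<delta>
  proof -
    have "dist (\<gamma> x) (\<gamma> r) powr p \<le> V y - V x"
      using V[of x r] V_le[of r y] x by auto
    moreover have "dist (\<gamma> v) (\<gamma> y) powr p \<le> V y - V x"
      using V[of v y] V_le[of x v] x by auto
    ultimately have *: "dist (\<gamma> x) (\<gamma> r) * dist (\<gamma> v) (\<gamma> y)
        \<le> \<delta> powr (2 - \<alpha> * p) * (V y - V x) powr \<alpha>"
      using \<alpha> \<delta> \<open>1 \<le> p\<close> by (intro mult_le_control_powr) auto
    have "cmod ((u \<circ> \<gamma>) r - (u \<circ> \<gamma>) x) * cmod ((h \<circ> \<gamma>) y - (h \<circ> \<gamma>) v)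
        \<le> (L * dist (\<gamma> x) (\<gamma> r)) * (H * dist (\<gamma> v) (\<gamma> y))"
    proof (intro mult_mono)
      show "cmod ((u \<circ> \<gamma>) r - (u \<circ> \<gamma>) x) \<le> L * dist (\<gamma> x) (\<gamma> r)"
        using lipschitz_onD[OF u, of "\<gamma> r" "\<gamma> x"] x by (simp add: dist_norm[symmetric] dist_commute)
      show "cmod ((h \<circ> \<gamma>) y - (h \<circ> \<gamma>) v) \<le> H * dist (\<gamma> v) (\<gamma> y)"
        using lipschitz_onD[OF h, of "\<gamma> y" "\<gamma> v"] x by (simp add: dist_norm[symmetric] dist_commute)
    qed (use lipschitz_on_nonneg[OF u] in auto)
    also have "\<dots> = L * H * (dist (\<gamma> x) (\<gamma> r) * dist (\<gamma> v) (\<gamma> y))" by (simp only: mult_ac)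
    also have "\<dots> \<le> L * H * (\<delta> powr (2 - \<alpha> * p) * (V y - V x) powr \<alpha>)"
      using * H lipschitz_on_nonneg[OF u] by (intro mult_left_mono) auto
    finally show ?thesis by (simp only: mult.assoc)
  qed
  have integrable: "path_young_integrable \<gamma> T u h" if u: "L-lipschitz_on ?S u" for u L
    unfolding path_young_integrable_def
  proof (rule young_integrableI[OF \<open>0 \<le> T\<close> _ V_mono])
    \<comment> \<open>the midpoint of \<open>1\<close> and \<open>2 / p\<close>, so that a positive power of \<open>\<delta>\<close> remains\<close>
    define \<alpha> where "\<alpha> = 1 / 2 + 1 / p"
    show "\<alpha> > 1" using assms(2,3) by (simp add: \<alpha>_def field_simps)
    have \<alpha>p: "\<alpha> * p = 1 + p / 2" using assms(2) by (simp add: \<alpha>_def field_simps)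
    define \<kappa> where "\<kappa> = 2 - \<alpha> * p"
    have \<kappa>: "\<kappa> > 0" using \<alpha>p \<open>p < 2\<close> by (simp add: \<kappa>_def)
    have L: "0 \<le> L" using u by (rule lipschitz_on_nonneg)
    fix \<epsilon> :: real assume "\<epsilon> > 0"
    define \<eta> where "\<eta> = \<epsilon> / (L * H + 1)"
    define \<delta> where "\<delta> = \<eta> powr (1 / \<kappa>)"
    have LH: "0 \<le> L * H" using L H by simp
    then have "\<eta> > 0" using \<open>\<epsilon> > 0\<close> by (simp add: \<eta>_def)
    then have \<delta>: "\<delta> > 0" "\<delta> powr \<kappa> = \<eta>" using \<kappa> by (simp_all add: \<delta>_def powr_powr)
    have "L * H * \<eta> \<le> \<epsilon>" using LH \<open>\<epsilon> > 0\<close> by (simp add: \<eta>_def field_simps)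
    have "uniformly_continuous_on {0..T} \<gamma>"
      using cont by (intro compact_uniformly_continuous) auto
    then obtain d where d: "d > 0"
      "\<And>s t. s \<in> {0..T} \<Longrightarrow> t \<in> {0..T} \<Longrightarrow> dist s t < d \<Longrightarrow> dist (\<gamma> s) (\<gamma> t) < \<delta>"
      using \<delta>(1) unfolding uniformly_continuous_on_def by metis
    have "cmod ((u \<circ> \<gamma>) r - (u \<circ> \<gamma>) x) * cmod ((h \<circ> \<gamma>) y - (h \<circ> \<gamma>) v)
        \<le> \<epsilon> * (V y - V x) powr \<alpha>"
      if x: "0 \<le> x" "y \<le> T" "y - x < d" "r \<in> {x..y}" "v \<in> {x..y}" for x y r v
    proof -
      have "cmod ((u \<circ> \<gamma>) r - (u \<circ> \<gamma>) x) * cmod ((h \<circ> \<gamma>) y - (h \<circ> \<gamma>) v)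
          \<le> L * H * \<delta> powr (2 - \<alpha> * p) * (V y - V x) powr \<alpha>"
      proof (rule product[OF u])
        show "dist (\<gamma> x) (\<gamma> r) \<le> \<delta>" using d(2)[of x r] x by (auto simp: dist_real_def)
        show "dist (\<gamma> v) (\<gamma> y) \<le> \<delta>" using d(2)[of v y] x by (auto simp: dist_real_def)
        show "0 \<le> \<alpha>" using \<open>\<alpha> > 1\<close> by simp
        show "\<alpha> * p \<le> 2" using \<alpha>p \<open>p < 2\<close> by simp
      qed (use x in auto)
      also have "\<dots> \<le> \<epsilon> * (V y - V x) powr \<alpha>"
        using \<delta>(2) \<open>L * H * \<eta> \<le> \<epsilon>\<close> unfolding \<kappa>_def by (intro mult_right_mono) auto
      finally show ?thesis .
    qed
    then show "\<exists>d>0. \<forall>x y r v. 0 \<le> x \<longrightarrow> y \<le> T \<longrightarrow> y - x < d \<longrightarrow> r \<in> {x..y} \<longrightarrow> v \<in> {x..y} \<longrightarrow>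
        cmod ((u \<circ> \<gamma>) r - (u \<circ> \<gamma>) x) * cmod ((h \<circ> \<gamma>) y - (h \<circ> \<gamma>) v)
          \<le> \<epsilon> * (V y - V x) powr \<alpha>"
      using d(1) by blast
  qed
  \<comment> \<open>the extreme exponent: the power of \<open>\<delta>\<close> becomes \<open>\<delta> powr 0 = 1\<close> for any bound \<open>\<delta> > 0\<close>\<close>
  define \<alpha> where "\<alpha> = 2 / p"
  have \<alpha>: "\<alpha> > 1" "\<alpha> * p = 2" using assms(2,3) by (simp_all add: \<alpha>_def)
  define C1 where "C1 = H * dist (\<gamma> 0) (\<gamma> T)"
  define C2 where "C2 = 2 * ((1 + sewing_constant \<alpha>) * H * (V T - V 0) powr \<alpha>)"
  have C: "C1 \<ge> 0" "C2 \<ge> 0" using H sewing_constant(1)[OF \<alpha>(1)] by (simp_all add: C1_def C2_def)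
  show ?thesis
  proof (rule that[of "C1 + C2"])
    fix u L M assume u: "L-lipschitz_on ?S u" and M: "\<And>x. x \<in> ?S \<Longrightarrow> cmod (u x) \<le> M"
    let ?I = "path_young_integral \<gamma> T u h"
    have L: "0 \<le> L" using u by (rule lipschitz_on_nonneg)
    have mem: "\<gamma> 0 \<in> ?S" "\<gamma> T \<in> ?S" using \<open>0 \<le> T\<close> by auto
    have "0 \<le> M" using M[OF mem(1)] norm_ge_zero[of "u (\<gamma> 0)"] by linarith
    have I: "has_young_integral (u \<circ> \<gamma>) (h \<circ> \<gamma>) 0 T ?I"
      using has_young_integral_path_young_integral[OF \<open>0 \<le> T\<close> integrable[OF u]] .
    have "cmod ((u \<circ> \<gamma>) 0 * ((h \<circ> \<gamma>) T - (h \<circ> \<gamma>) 0) - ?I)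
        \<le> 2 * ((1 + sewing_constant \<alpha>) * (L * H) * (V T - V 0) powr \<alpha>)"
    proof (rule young_inequality[OF \<open>0 \<le> T\<close> \<alpha>(1) _ V_mono _ I])
      show "0 \<le> L * H" using L H by simp
      fix x y r v assume "0 \<le> x" "y \<le> T" "r \<in> {x..y}" "v \<in> {x..y}"
      then show "cmod ((u \<circ> \<gamma>) r - (u \<circ> \<gamma>) x) * cmod ((h \<circ> \<gamma>) y - (h \<circ> \<gamma>) v)
          \<le> L * H * (V y - V x) powr \<alpha>"
        using product[OF u, of x y r v \<alpha> "dist (\<gamma> x) (\<gamma> r) + dist (\<gamma> v) (\<gamma> y) + 1"] \<alpha>
          zero_le_dist[of "\<gamma> x" "\<gamma> r"] zero_le_dist[of "\<gamma> v" "\<gamma> y"]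
        by (simp add: add_nonneg_eq_0_iff split: if_splits)
    qed
    also have "\<dots> = L * C2" by (simp add: C2_def)
    finally have 1: "cmod ((u \<circ> \<gamma>) 0 * ((h \<circ> \<gamma>) T - (h \<circ> \<gamma>) 0) - ?I) \<le> L * C2" .
    have "cmod ((u \<circ> \<gamma>) 0 * ((h \<circ> \<gamma>) T - (h \<circ> \<gamma>) 0)) \<le> M * C1"
      unfolding norm_mult C1_def
      using M[OF mem(1)] \<open>0 \<le> M\<close> lipschitz_onD[OF h mem(2,1)]
      by (intro mult_mono) (auto simp: dist_norm[symmetric] dist_commute)
    with 1 have "cmod ?I \<le> M * C1 + L * C2"
      using norm_triangle_ineq4[of "(u \<circ> \<gamma>) 0 * ((h \<circ> \<gamma>) T - (h \<circ> \<gamma>) 0)"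
        "(u \<circ> \<gamma>) 0 * ((h \<circ> \<gamma>) T - (h \<circ> \<gamma>) 0) - ?I"] by simp
    also have "\<dots> \<le> (C1 + C2) * (M + L)"
      using C L \<open>0 \<le> M\<close> by (simp add: algebra_simps)
    finally show "path_young_integrable \<gamma> T u h \<and> cmod ?I \<le> (C1 + C2) * (M + L)"
      using integrable[OF u] by simp
  qed
qed

section \<open>The binomial series\<close>

lemma norm_exp_minus_one_le:
  fixes z :: "'a::{real_normed_algebra_1,banach}"
  shows "norm (exp z - 1) \<le> exp (norm z) - 1"
proof -
  have "norm (\<Sum>n. inverse (fact (Suc n)) *\<^sub>R z ^ Suc n)
      \<le> (\<Sum>n. inverse (fact (Suc n)) *\<^sub>R norm z ^ Suc n)"
  proof (rule norm_suminf_le)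
    show "norm (inverse (fact (Suc n)) *\<^sub>R z ^ Suc n) \<le> inverse (fact (Suc n)) *\<^sub>R norm z ^ Suc n" for n
      unfolding norm_scaleR using norm_power_ineq[of z "Suc n"]
      by (simp add: mult_left_mono del: power_Suc fact_Suc)
    show "summable (\<lambda>n. inverse (fact (Suc n)) *\<^sub>R norm z ^ Suc n)"
      using summable_exp_generic[of "norm z"]
      by (subst summable_Suc_iff) simp
  qed
  then show ?thesis
    using exp_first_term[of z] exp_first_term[of "norm z"] by simp
qed

lemma norm_power_diff_le:
  fixes z w :: "'a::real_normed_field"
  assumes "norm z \<le> r" "norm w \<le> r"
  shows "norm (z ^ n - w ^ n) \<le> real n * r ^ (n - 1) * norm (z - w)"
proof (induction n)
  case (Suc n)
  have r: "0 \<le> r" using assms(1) norm_ge_zero[of z] by linarith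
  have "z ^ Suc n - w ^ Suc n = z * (z ^ n - w ^ n) + w ^ n * (z - w)"
    by (simp add: algebra_simps)
  also have "norm \<dots> \<le> norm z * norm (z ^ n - w ^ n) + norm w ^ n * norm (z - w)"
    using norm_triangle_ineq[of "z * (z ^ n - w ^ n)" "w ^ n * (z - w)"]
    by (simp add: norm_mult norm_power)
  also have "\<dots> \<le> r * (real n * r ^ (n - 1) * norm (z - w)) + r ^ n * norm (z - w)"
    using assms r Suc by (intro add_mono mult_mono power_mono) auto
  also have "\<dots> = real (Suc n) * r ^ (Suc n - 1) * norm (z - w)"
    by (cases n) (simp_all add: algebra_simps)
  finally show ?case .
qed simp

lemma suminf_tail_tendsto_zero:
  fixes f :: "nat \<Rightarrow> real"
  assumes "summable f"
  shows "(\<lambda>N. \<Sum>n. f (n + N)) \<longlonglongrightarrow> 0"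
proof -
  have "(\<lambda>N. suminf f - (\<Sum>n<N. f n)) \<longlonglongrightarrow> suminf f - suminf f"
    by (intro tendsto_diff tendsto_const summable_LIMSEQ[OF assms])
  then show ?thesis by (simp add: suminf_minus_initial_segment[OF assms])
qed

text \<open>For \<open>a N\<close> and \<open>b N\<close>, take the tails of the series of the absolute values of the terms and of the terms
  of the derivative at radius \<open>r\<close>. Both series converge because \<open>r\<close> is smaller than the radius of
  convergence. The case \<open>N = 0\<close> says that \<open>(1 + z) powr s\<close> itself is bounded and Lipschitz.\<close>

lemma binomial_remainder_tendsto_zero:
  fixes s :: complex
  assumes "0 \<le> r" "r < 1"
  obtains a b :: "nat \<Rightarrow> real" where "a \<longlonglongrightarrow> 0" "b \<longlonglongrightarrow> 0"
    and "\<And>N z. cmod z \<le> r \<Longrightarrow> cmod ((1 + z) powr s - (\<Sum>n<N. (s gchoose n) * z ^ n)) \<le> a N"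
    and "\<And>N z w. cmod z \<le> r \<Longrightarrow> cmod w \<le> r \<Longrightarrow>
      cmod (((1 + z) powr s - (\<Sum>n<N. (s gchoose n) * z ^ n)) -
            ((1 + w) powr s - (\<Sum>n<N. (s gchoose n) * w ^ n))) \<le> b N * cmod (z - w)"
proof -
  define c where "c n = cmod (s gchoose n)" for n
  have c_summable: "summable (\<lambda>n. c n * x ^ n)" if "norm x < 1" for x :: real
  proof -
    obtain y where y: "norm x < y" "y < 1" using dense[of "norm x" 1] \<open>norm x < 1\<close> by auto
    have "summable (\<lambda>n. (s gchoose n) * of_real y ^ n)"
      using gen_binomial_complex[of "of_real y" s] y by (simp add: sums_iff)
    then have "summable (\<lambda>n. norm ((s gchoose n) * of_real x ^ n))"
      by (rule powser_insidea) (use y in auto)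
    then show ?thesis
      by (intro summable_norm_cancel[of "\<lambda>n. c n * x ^ n"])
        (simp add: c_def norm_mult norm_power abs_mult power_abs)
  qed
  have "summable (\<lambda>n. diffs c n * r ^ n)"
    using assms c_summable by (intro termdiff_converges[of r 1]) auto
  then have c'_summable: "summable (\<lambda>n. real n * c n * r ^ (n - 1))"
    by (subst summable_Suc_iff[symmetric]) (simp add: diffs_def)
  have r_summable: "summable (\<lambda>n. c n * r ^ n)" using c_summable assms by simp
  define \<rho> where "\<rho> N z = (1 + z) powr s - (\<Sum>n<N. (s gchoose n) * z ^ n)" for N z
  have \<rho>: "(\<lambda>n. (s gchoose (n + N)) * z ^ (n + N)) sums \<rho> N z" if "cmod z \<le> r" for N z
    using gen_binomial_complex[of z s] that assms(2) unfolding \<rho>_def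
    by (intro sums_split_initial_segment) auto
  show ?thesis
  proof (rule that[OF suminf_tail_tendsto_zero[OF r_summable]
        suminf_tail_tendsto_zero[OF c'_summable]], unfold \<rho>_def[symmetric])
    fix N z assume z: "cmod z \<le> r"
    have "cmod (\<Sum>n. (s gchoose (n + N)) * z ^ (n + N)) \<le> (\<Sum>n. c (n + N) * r ^ (n + N))"
    proof (rule norm_suminf_le)
      show "cmod ((s gchoose (n + N)) * z ^ (n + N)) \<le> c (n + N) * r ^ (n + N)" for n
        using z by (simp add: norm_mult norm_power c_def mult_left_mono power_mono del: power_add)
      show "summable (\<lambda>n. c (n + N) * r ^ (n + N))" by (rule summable_ignore_initial_segment[OF r_summable])
    qed
    then show "cmod (\<rho> N z) \<le> (\<Sum>n. c (n + N) * r ^ (n + N))"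
      using \<rho>[OF z] by (simp add: sums_iff)
  next
    fix N z w assume z: "cmod z \<le> r" and w: "cmod w \<le> r"
    let ?b = "\<lambda>n. real (n + N) * c (n + N) * r ^ (n + N - 1)"
    have b: "summable ?b" by (rule summable_ignore_initial_segment[OF c'_summable])
    have "(\<lambda>n. (s gchoose (n + N)) * (z ^ (n + N) - w ^ (n + N))) sums (\<rho> N z - \<rho> N w)"
      using sums_diff[OF \<rho>[OF z] \<rho>[OF w]] by (simp add: right_diff_distrib)
    moreover have "cmod (\<Sum>n. (s gchoose (n + N)) * (z ^ (n + N) - w ^ (n + N)))
        \<le> (\<Sum>n. ?b n * cmod (z - w))"
    proof (rule norm_suminf_le)
      fix n
      have "cmod ((s gchoose (n + N)) * (z ^ (n + N) - w ^ (n + N)))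
          \<le> c (n + N) * (real (n + N) * r ^ (n + N - 1) * cmod (z - w))"
        unfolding norm_mult c_def by (intro mult_left_mono norm_power_diff_le z w) auto
      then show "cmod ((s gchoose (n + N)) * (z ^ (n + N) - w ^ (n + N))) \<le> ?b n * cmod (z - w)"
        by (simp only: mult_ac)
    qed (rule summable_mult2[OF b])
    ultimately show "cmod (\<rho> N z - \<rho> N w) \<le> suminf ?b * cmod (z - w)"
      using suminf_mult2[OF b, of "cmod (z - w)"] by (simp add: sums_iff)
  qed
qed

section \<open>Integrating the series\<close>

lemma lipschitz_on_mult_bounded:
  fixes u v :: "'a::metric_space \<Rightarrow> 'b::real_normed_algebra"
  assumes u: "L-lipschitz_on S u" "\<And>x. x \<in> S \<Longrightarrow> norm (u x) \<le> M"
    and v: "K-lipschitz_on S v" "\<And>x. x \<in> S \<Longrightarrow> norm (v x) \<le> N"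
    and "0 \<le> M" "0 \<le> N"
  shows "(L * N + M * K)-lipschitz_on S (\<lambda>x. u x * v x)"
proof (rule lipschitz_onI)
  have nonneg: "0 \<le> L" "0 \<le> K" using u(1) v(1) lipschitz_on_nonneg by auto
  then show "0 \<le> L * N + M * K" using assms(5,6) by simp
  fix x y assume xy: "x \<in> S" "y \<in> S"
  have "u x * v x - u y * v y = (u x - u y) * v x + u y * (v x - v y)"
    by (simp add: algebra_simps)
  then have "dist (u x * v x) (u y * v y) \<le> norm (u x - u y) * norm (v x) + norm (u y) * norm (v x - v y)"
    using norm_triangle_ineq[of "(u x - u y) * v x" "u y * (v x - v y)"]
      norm_mult_ineq[of "u x - u y" "v x"] norm_mult_ineq[of "u y" "v x - v y"]
    by (simp add: dist_norm)
  also have "\<dots> \<le> (L * dist x y) * N + M * (K * dist x y)"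
    using lipschitz_onD[OF u(1) xy] lipschitz_onD[OF v(1) xy] u(2) v(2) xy assms(5,6) nonneg
    by (intro add_mono mult_mono) (auto simp: dist_norm[symmetric])
  finally show "dist (u x * v x) (u y * v y) \<le> (L * N + M * K) * dist x y"
    by (simp add: algebra_simps)
qed

text \<open>A logarithm with imaginary part in \<open>(-\<pi>, \<pi>)\<close> is the principal one.\<close>

lemma branch_power_eq_powr:
  assumes "continuous_log_branch Log C" "z \<in> C" "\<bar>Im (Log z)\<bar> < pi"
  shows "branch_power Log z s = z powr s"
proof -
  have z: "exp (Log z) = z" using assms by (simp add: continuous_log_branch_def)
  have "Ln (exp (Log z)) = Log z" using assms(3) by (intro Ln_exp) auto
  then have "Ln z = Log z" by (simp add: z)
  moreover have "z \<noteq> 0" using z by (metis exp_not_eq_zero)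
  ultimately show ?thesis by (simp add: branch_power_def powr_def)
qed

lemma alternating_binomial_sum:
  fixes c z w :: "'a::comm_ring_1"
  shows "(\<Sum>k=0..n. (-1) ^ n * c * ((-1) ^ k * of_nat (n choose k)) * (z ^ k * w))
           = c * (z - 1) ^ n * w"
proof -
  have "(\<Sum>k=0..n. (-1) ^ n * c * ((-1) ^ k * of_nat (n choose k)) * (z ^ k * w))
      = (-1) ^ n * c * w * (\<Sum>k\<le>n. of_nat (n choose k) * (- z) ^ k * 1 ^ (n - k))"
    unfolding sum_distrib_left atLeast0AtMost
    by (intro sum.cong refl) (simp add: power_minus[of z] mult_ac)
  also have "\<dots> = (-1) ^ n * c * w * (1 - z) ^ n"
    using binomial_ring[of "- z" 1 n] by simp
  also have "\<dots> = c * ((-1) * (1 - z)) ^ n * w"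
    by (simp only: power_mult_distrib mult_ac)
  finally show ?thesis by simp
qed

theorem theorem1p1:
  fixes \<gamma> :: "real \<Rightarrow> 'v::euclidean_space"
    and T p :: real
    and f g h :: "'v \<Rightarrow> complex"
    and Log :: "complex \<Rightarrow> complex"
    and s :: complex
  assumes "0 \<le> T"
    and "1 \<le> p" and "p < 2"
    and "continuous_on {0..T} \<gamma>"
    and "finite_p_variation p 0 T \<gamma>"
    and "\<exists>K. K-lipschitz_on (\<gamma> ` {0..T}) f"
    and "\<exists>K. K-lipschitz_on (\<gamma> ` {0..T}) g"
    and "\<exists>K. K-lipschitz_on (\<gamma> ` {0..T}) h"
    and "0 \<notin> convex hull (f ` \<gamma> ` {0..T})"
    and "continuous_log_branch Log (convex hull (f ` \<gamma> ` {0..T}))"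
    and "\<forall>z \<in> convex hull (f ` \<gamma> ` {0..T}). cmod (Log z) < ln 2"
  shows "(\<forall>k. path_young_integrable \<gamma> T (\<lambda>x. f x ^ k * g x) h) \<and>
    path_young_integrable \<gamma> T (\<lambda>x. branch_power Log (f x) s * g x) h \<and>
    (\<lambda>n. (-1) ^ n * (s gchoose n) *
           (\<Sum>k=0..n. (-1) ^ k * of_nat (n choose k) *
              path_young_integral \<gamma> T (\<lambda>x. f x ^ k * g x) h))
      sums path_young_integral \<gamma> T (\<lambda>x. branch_power Log (f x) s * g x) h"
proof -
  let ?S = "\<gamma> ` {0..T}" and ?J = "\<lambda>u. path_young_integral \<gamma> T u h"
  obtain Lf Lg H where f: "Lf-lipschitz_on ?S f" and g: "Lg-lipschitz_on ?S g"
    and h: "H-lipschitz_on ?S h"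
    using assms(6-8) by blast
  obtain C where C:
    "\<And>u L M. L-lipschitz_on ?S u \<Longrightarrow> (\<And>x. x \<in> ?S \<Longrightarrow> cmod (u x) \<le> M) \<Longrightarrow>
       path_young_integrable \<gamma> T u h \<and> cmod (?J u) \<le> C * (M + L)"
    using path_young_integral_bound[OF assms(1-5) h] by blast
  have S: "compact ?S" "?S \<noteq> {}" using assms(1,4) by (auto intro: compact_continuous_image)
  have hull: "f x \<in> convex hull (f ` ?S)" if "x \<in> ?S" for x using that by (intro hull_inc) auto
  have near_1: "cmod (f x - 1) < 1" if "x \<in> ?S" for x
  proof -
    have "cmod (exp (Log (f x)) - 1) < 1"
      using norm_exp_minus_one_le[of "Log (f x)"] assms(11) hull[OF that]
      by (smt (verit) exp_ln exp_less_mono)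
    then show ?thesis
      using assms(10) hull[OF that] by (simp add: continuous_log_branch_def)
  qed
  have branch: "branch_power Log (f x) s = (1 + (f x - 1)) powr s" if "x \<in> ?S" for x
  proof -
    have "\<bar>Im (Log (f x))\<bar> < pi"
      using abs_Im_le_cmod[of "Log (f x)"] assms(11) hull[OF that] ln_2_less_1 pi_gt3 by fastforce
    then show ?thesis using branch_power_eq_powr[OF assms(10) hull[OF that]] by simp
  qed
  \<comment> \<open>compactness turns the strict inequality into a uniform one\<close>
  obtain r where r: "0 \<le> r" "r < 1" "\<And>x. x \<in> ?S \<Longrightarrow> cmod (f x - 1) \<le> r"
  proof -
    have "continuous_on ?S (\<lambda>x. cmod (f x - 1))"
      by (intro continuous_intros lipschitz_on_continuous_on[OF f])
    then obtain y where "y \<in> ?S" "\<forall>x\<in>?S. cmod (f x - 1) \<le> cmod (f y - 1)"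
      using continuous_attains_sup[OF S] by blast
    then show ?thesis using that[of "cmod (f y - 1)"] near_1 by auto
  qed
  obtain G where G: "0 \<le> G" "\<And>x. x \<in> ?S \<Longrightarrow> cmod (g x) \<le> G"
  proof -
    have "bounded (g ` ?S)"
      by (intro compact_imp_bounded compact_continuous_image lipschitz_on_continuous_on[OF g] S)
    then show ?thesis using that unfolding bounded_pos by (metis image_eqI less_imp_le)
  qed
  have f_2: "cmod (f x) \<le> 2" if "x \<in> ?S" for x
    using norm_triangle_ineq[of "f x - 1" 1] near_1[OF that] by simp
  have P: "path_young_integrable \<gamma> T (\<lambda>x. f x ^ k * g x) h" for k
  proof -
    have "(real k * 2 ^ (k - 1) * Lf)-lipschitz_on ?S (\<lambda>x. f x ^ k)"
    proof (rule lipschitz_onI)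
      show "0 \<le> real k * 2 ^ (k - 1) * Lf" using lipschitz_on_nonneg[OF f] by simp
      fix x y assume xy: "x \<in> ?S" "y \<in> ?S"
      have "dist (f x ^ k) (f y ^ k) \<le> real k * 2 ^ (k - 1) * dist (f x) (f y)"
        unfolding dist_norm using f_2 xy by (intro norm_power_diff_le) auto
      also have "\<dots> \<le> real k * 2 ^ (k - 1) * (Lf * dist x y)"
        by (intro mult_left_mono lipschitz_onD[OF f] xy) auto
      finally show "dist (f x ^ k) (f y ^ k) \<le> real k * 2 ^ (k - 1) * Lf * dist x y" by simp
    qed
    moreover have pow: "cmod (f x ^ k) \<le> 2 ^ k" if "x \<in> ?S" for x
      using f_2[OF that] by (simp add: norm_power power_mono)
    ultimately have "(real k * 2 ^ (k - 1) * Lf * G + 2 ^ k * Lg)-lipschitz_on ?S (\<lambda>x. f x ^ k * g x)"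
      using G by (intro lipschitz_on_mult_bounded g) auto
    moreover have "cmod (f x ^ k * g x) \<le> 2 ^ k * G" if "x \<in> ?S" for x
      unfolding norm_mult using pow G that by (intro mult_mono) auto
    ultimately show ?thesis using C by blast
  qed
  obtain a b :: "nat \<Rightarrow> real" where ab: "a \<longlonglongrightarrow> 0" "b \<longlonglongrightarrow> 0"
    and a: "\<And>N z. cmod z \<le> r \<Longrightarrow> cmod ((1 + z) powr s - (\<Sum>n<N. (s gchoose n) * z ^ n)) \<le> a N"
    and b: "\<And>N z w. cmod z \<le> r \<Longrightarrow> cmod w \<le> r \<Longrightarrow>
      cmod (((1 + z) powr s - (\<Sum>n<N. (s gchoose n) * z ^ n)) -
            ((1 + w) powr s - (\<Sum>n<N. (s gchoose n) * w ^ n))) \<le> b N * cmod (z - w)"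
    using binomial_remainder_tendsto_zero[OF r(1,2), of s] by blast
  define \<rho> where
    "\<rho> N x = branch_power Log (f x) s - (\<Sum>n<N. (s gchoose n) * (f x - 1) ^ n)" for N x
  have \<rho>_bound: "cmod (\<rho> N x) \<le> a N" if "x \<in> ?S" for N x
    using a[of "f x - 1" N] r(3) branch that by (simp add: \<rho>_def)
  have a_nonneg: "0 \<le> a N" for N using S(2) \<rho>_bound norm_ge_zero order_trans by blast
  have \<rho>_lipschitz: "(\<bar>b N\<bar> * Lf)-lipschitz_on ?S (\<rho> N)" for N
  proof (rule lipschitz_onI)
    show "0 \<le> \<bar>b N\<bar> * Lf" using lipschitz_on_nonneg[OF f] by simp
    fix x y assume xy: "x \<in> ?S" "y \<in> ?S"
    have "dist (\<rho> N x) (\<rho> N y) \<le> b N * dist (f x) (f y)"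
      using b[of "f x - 1" "f y - 1" N] r(3) branch xy by (simp add: \<rho>_def dist_norm)
    also have "\<dots> \<le> \<bar>b N\<bar> * (Lf * dist x y)"
      by (intro mult_mono lipschitz_onD[OF f] xy) auto
    finally show "dist (\<rho> N x) (\<rho> N y) \<le> \<bar>b N\<bar> * Lf * dist x y" by simp
  qed
  define E where "E N = C * (a N * G + (\<bar>b N\<bar> * Lf * G + a N * Lg))" for N
  \<comment> \<open>the case \<open>N = 0\<close> contains the integrability of \<open>f\<^sup>s g\<close>\<close>
  have R: "path_young_integrable \<gamma> T (\<lambda>x. \<rho> N x * g x) h \<and> cmod (?J (\<lambda>x. \<rho> N x * g x)) \<le> E N" for N
    unfolding E_def
  proof (rule C)
    show "(\<bar>b N\<bar> * Lf * G + a N * Lg)-lipschitz_on ?S (\<lambda>x. \<rho> N x * g x)"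
      using G a_nonneg \<rho>_bound by (intro lipschitz_on_mult_bounded g \<rho>_lipschitz) auto
    show "cmod (\<rho> N x * g x) \<le> a N * G" if "x \<in> ?S" for x
      unfolding norm_mult using \<rho>_bound G a_nonneg that by (intro mult_mono) auto
  qed
  have power_integrable: "path_young_integrable \<gamma> T (\<lambda>x. branch_power Log (f x) s * g x) h"
    using R[of 0] by (simp add: \<rho>_def)
  define A where "A n = (-1) ^ n * (s gchoose n) *
      (\<Sum>k=0..n. (-1) ^ k * of_nat (n choose k) * ?J (\<lambda>x. f x ^ k * g x))" for n
  have A_eq: "A n = (\<Sum>k=0..n. (-1) ^ n * (s gchoose n) * ((-1) ^ k * of_nat (n choose k)) *
      ?J (\<lambda>x. f x ^ k * g x))" for n
    by (simp only: A_def sum_distrib_left mult.assoc)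
  note has = has_young_integral_path_young_integral[OF \<open>0 \<le> T\<close>]
  have remainder: "?J (\<lambda>x. \<rho> N x * g x)
      = ?J (\<lambda>x. branch_power Log (f x) s * g x) - (\<Sum>n<N. A n)" for N
  proof -
    have "has_young_integral (\<lambda>t. \<Sum>k=0..n. (-1) ^ n * (s gchoose n) * ((-1) ^ k * of_nat (n choose k)) *
          ((\<lambda>x. f x ^ k * g x) \<circ> \<gamma>) t) (h \<circ> \<gamma>) 0 T
        (\<Sum>k=0..n. (-1) ^ n * (s gchoose n) * ((-1) ^ k * of_nat (n choose k)) *
          ?J (\<lambda>x. f x ^ k * g x))" for n
      by (intro has_young_integral_sum has_young_integral_cmult has P)
    then have "has_young_integral (\<lambda>t. (s gchoose n) * (f (\<gamma> t) - 1) ^ n * g (\<gamma> t)) (h \<circ> \<gamma>) 0 T (A n)" for n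
      unfolding o_def alternating_binomial_sum A_eq .
    then have "has_young_integral (\<lambda>t. ((\<lambda>x. branch_power Log (f x) s * g x) \<circ> \<gamma>) t -
          (\<Sum>n<N. (s gchoose n) * (f (\<gamma> t) - 1) ^ n * g (\<gamma> t))) (h \<circ> \<gamma>) 0 T
        (?J (\<lambda>x. branch_power Log (f x) s * g x) - (\<Sum>n<N. A n))"
      by (intro has_young_integral_diff has_young_integral_sum has power_integrable)
    moreover have "(\<lambda>t. ((\<lambda>x. branch_power Log (f x) s * g x) \<circ> \<gamma>) t -
          (\<Sum>n<N. (s gchoose n) * (f (\<gamma> t) - 1) ^ n * g (\<gamma> t))) = (\<lambda>x. \<rho> N x * g x) \<circ> \<gamma>"
      by (simp add: fun_eq_iff \<rho>_def left_diff_distrib sum_distrib_right)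
    ultimately show ?thesis
      using young_integral_unique[OF \<open>0 \<le> T\<close>] by (simp add: path_young_integral_def)
  qed
  have "E \<longlonglongrightarrow> C * (0 * G + (\<bar>0\<bar> * Lf * G + 0 * Lg))"
    unfolding E_def by (intro tendsto_intros ab)
  then have "E \<longlonglongrightarrow> 0" by simp
  then have "(\<lambda>N. ?J (\<lambda>x. \<rho> N x * g x)) \<longlonglongrightarrow> 0"
    by (rule Lim_null_comparison[rotated]) (use R in simp)
  then have "(\<lambda>N. ?J (\<lambda>x. branch_power Log (f x) s * g x) - (?J (\<lambda>x. branch_power Log (f x) s * g x) - (\<Sum>n<N. A n)))
      \<longlonglongrightarrow> ?J (\<lambda>x. branch_power Log (f x) s * g x) - 0"
    unfolding remainder by (intro tendsto_diff tendsto_const)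
  then have "A sums ?J (\<lambda>x. branch_power Log (f x) s * g x)" by (simp add: sums_def)
  then show ?thesis using P power_integrable unfolding A_def by simp
qed

end
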